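(* Let $C=C(\{C_s\}_{s\in S})\subseteq\Sigma^n$ be a lifted code such that all the codes $C_s$ have the same cardinality, and let $L\subseteq\prod_{s\in S}C_s$ be its line code. Let $G$ be a graph with a labelling $\ell:G\to P([n])$ of its vertices and edges such that $\ell$ restricts to a bijection from the vertex set of $G$ onto $S$ and $\ell(v)\supseteq\ell(e)$ for every edge $e$ and vertex $v$ of $e$. Suppose that every vertex of $G$ belongs to at least $d_{\min}\geq 1$ and at most $d_{\max}$ edges. If the tester $T_{G,\ell}$ for $L$ has soundness $\mu$ ($\mu\ge0$), then the natural tester of $C$ has soundness $$\frac{k_{\min}D_{\min}}{k_{\max}D_{\max}}\cdot\frac{\mu}{\mu+2d_{\max}d_{\min}^{-1}}.$$
   Context: $\Sigma$ is a finite alphabet, $[n]=\{1,\dots,n\}$, $P([n])$ its power set; $\mathrm{dist}$ denotes normalized Hamming distance (also on $\prod_{s\in S}C_s$, counting coordinates $s$). Graphs are finite, may have multiple edges, no loops. **Lifted code.** $S$ is a collection of nonempty subsets of $[n]$ with $\bigcup_{s\in S}s=[n]$ and $C_s\subseteq\Sigma^s$ is a nonempty code for each $s\in S$; $C(\{C_s\}_{s\in S})=\{g\in\Sigma^n:g|_s\in C_s\ \forall s\in S\}$, assumed nonempty. Its natural tester: given $g\in\Sigma^n$, choose $s\in S$ uniformly at random and accept iff $g|_s\in C_s$. **Line code.** $L=\{(f_s)_{s\in S}\in\prod_{s\in S}C_s:f_s|_{s\cap s'}=f_{s'}|_{s\cap s'}\ \forall s,s'\in S\}$; identifying each $C_s$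 with a fixed set $\Sigma'$, $L$ is a code inside $\Sigma'^S$. **Tester $T_{G,\ell}$ for $L$.** Given $f=(f_s)_{s\in S}\in\prod_sC_s$, choose an edge $e$ of $G$ uniformly at random, with endpoints $u,v$, and accept iff $f_{\ell(u)}|_{\ell(e)}=f_{\ell(v)}|_{\ell(e)}$. **Soundness.** A tester for a code $D$ has soundness $\mu$ if $\mathrm{Prob}(\text{reject }f)\ge\mu\,\mathrm{dist}(f,D)$ for every word $f$. **Constants.** $k_{\min}=\min_{s\in S}|s|$, $k_{\max}=\max_{s\in S}|s|$, $D_{\min}=\min_{i\in[n]}\#\{s\in S:i\in s\}$, $D_{\max}=\max_{i\in[n]}\#\{s\in S:i\in s\}$. *)

theory Defs
  imports "HOL-Probability.Probability"
begin

(* A word over a finite index set I is an extensional function on I, i.e. an element of some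
   PiE I A, so that equality of words is equality on I and restriction to a subset is restrict. *)

definition hamming_dist :: "'i set \<Rightarrow> ('i \<Rightarrow> 'b) \<Rightarrow> ('i \<Rightarrow> 'b) \<Rightarrow> real" where
  "hamming_dist I f g = real (card {i \<in> I. f i \<noteq> g i}) / real (card I)"

(* The infimum is a minimum for nonempty D, since the distance takes finitely many values. *)
definition code_dist :: "'i set \<Rightarrow> ('i \<Rightarrow> 'b) \<Rightarrow> ('i \<Rightarrow> 'b) set \<Rightarrow> real" where
  "code_dist I f D = (INF g\<in>D. hamming_dist I f g)"

(* A tester maps a word to the distribution of its verdict; True means "accept". *)
type_synonym 'w tester = "'w \<Rightarrow> bool pmf"

(* W is the set of all words indexed by I, and D is the code being tested. *)
definition has_soundness ::
  "'i set \<Rightarrow> ('i \<Rightarrow> 'b) set \<Rightarrow> ('i \<Rightarrow> 'b) set \<Rightarrow> ('i \<Rightarrow> 'b) tester \<Rightarrow> real \<Rightarrow> bool" where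
  "has_soundness I W D T \<mu> \<longleftrightarrow> (\<forall>f\<in>W. pmf (T f) False \<ge> \<mu> * code_dist I f D)"

definition lifted_code ::
  "nat \<Rightarrow> 'a set \<Rightarrow> nat set set \<Rightarrow> (nat set \<Rightarrow> (nat \<Rightarrow> 'a) set) \<Rightarrow> (nat \<Rightarrow> 'a) set" where
  "lifted_code n \<Sigma> S C = {g \<in> {1..n} \<rightarrow>\<^sub>E \<Sigma>. \<forall>s\<in>S. restrict g s \<in> C s}"

definition natural_tester ::
  "nat set set \<Rightarrow> (nat set \<Rightarrow> (nat \<Rightarrow> 'a) set) \<Rightarrow> (nat \<Rightarrow> 'a) tester" where
  "natural_tester S C g = map_pmf (\<lambda>s. restrict g s \<in> C s) (pmf_of_set S)"

definition line_code ::
  "nat set set \<Rightarrow> (nat set \<Rightarrow> (nat \<Rightarrow> 'a) set) \<Rightarrow> (nat set \<Rightarrow> (nat \<Rightarrow> 'a)) set" where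
  "line_code S C = {f \<in> Pi\<^sub>E S C.
     \<forall>s\<in>S. \<forall>s'\<in>S. restrict (f s) (s \<inter> s') = restrict (f s') (s \<inter> s')}"

(* Finite undirected loopless graphs with multiple edges: distinct elements of E may have the
   same pair of endpoints. *)
locale multigraph =
  fixes V :: "'v set" and E :: "'e set" and ends :: "'e \<Rightarrow> 'v set"
  assumes finite_V: "finite V"
    and finite_E: "finite E"
    and ends_subset: "e \<in> E \<Longrightarrow> ends e \<subseteq> V"
    and card_ends: "e \<in> E \<Longrightarrow> card (ends e) = 2"

definition vertex_degree :: "'e set \<Rightarrow> ('e \<Rightarrow> 'v set) \<Rightarrow> 'v \<Rightarrow> nat" where
  "vertex_degree E ends v = card {e \<in> E. v \<in> ends e}"

(* The labelling is split into lV on vertices and lE on edges. *)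
definition edge_tester ::
  "'e set \<Rightarrow> ('e \<Rightarrow> 'v set) \<Rightarrow> ('v \<Rightarrow> nat set) \<Rightarrow> ('e \<Rightarrow> nat set)
     \<Rightarrow> (nat set \<Rightarrow> (nat \<Rightarrow> 'a)) tester" where
  "edge_tester E ends lV lE f = map_pmf
     (\<lambda>e. \<forall>u\<in>ends e. \<forall>v\<in>ends e. restrict (f (lV u)) (lE e) = restrict (f (lV v)) (lE e))
     (pmf_of_set E)"

definition k_min :: "nat set set \<Rightarrow> nat" where
  "k_min S = Min (card ` S)"

definition k_max :: "nat set set \<Rightarrow> nat" where
  "k_max S = Max (card ` S)"

definition D_min :: "nat \<Rightarrow> nat set set \<Rightarrow> nat" where
  "D_min n S = Min ((\<lambda>i. card {s \<in> S. i \<in> s}) ` {1..n})"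

definition D_max :: "nat \<Rightarrow> nat set set \<Rightarrow> nat" where
  "D_max n S = Max ((\<lambda>i. card {s \<in> S. i \<in> s}) ` {1..n})"

end

theory Submission imports Defs begin

text \<open>
  Given a word \<open>g\<close>, replace each local view \<open>g|\<^sub>s\<close> that violates \<open>C\<^sub>s\<close> by an arbitrary element of
  \<open>C\<^sub>s\<close>. The edge tester can reject the resulting \<open>f\<close> only on edges meeting a violated \<open>s\<close>, so
  soundness for the line code puts \<open>f\<close>, and hence the family of local views of \<open>g\<close>, close to some
  \<open>h\<close> in \<open>L\<close>. Gluing turns \<open>h\<close> into a word \<open>g'\<close> of the lifted code, and double counting the
  pairs \<open>i \<in> s\<close> with \<open>g i \<noteq> g' i\<close> compares the distance of local views with that of \<open>g\<close> and \<open>g'\<close>.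
\<close>

section \<open>Hamming distance and distance to a code\<close>

lemma hamming_dist_nonneg: "hamming_dist I f g \<ge> 0"
  by (simp add: hamming_dist_def)

lemma hamming_dist_triangle:
  assumes "finite I"
  shows "hamming_dist I f h \<le> hamming_dist I f g + hamming_dist I g h"
proof -
  have "card {i \<in> I. f i \<noteq> h i} \<le> card ({i \<in> I. f i \<noteq> g i} \<union> {i \<in> I. g i \<noteq> h i})"
    using assms by (intro card_mono) auto
  also have "\<dots> \<le> card {i \<in> I. f i \<noteq> g i} + card {i \<in> I. g i \<noteq> h i}"
    by (rule card_Un_le)
  finally have "real (card {i \<in> I. f i \<noteq> h i})
      \<le> real (card {i \<in> I. f i \<noteq> g i}) + real (card {i \<in> I. g i \<noteq> h i})"
    by linarith
  then show ?thesis
    unfolding hamming_dist_def add_divide_distrib[symmetric] by (rule divide_right_mono) simp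
qed

lemma code_dist_le:
  assumes "g \<in> D"
  shows "code_dist I f D \<le> hamming_dist I f g"
proof -
  have "bdd_below (hamming_dist I f ` D)"
    by (rule bdd_belowI2[of _ 0]) (rule hamming_dist_nonneg)
  then show ?thesis
    unfolding code_dist_def using assms by (rule cINF_lower)
qed

lemma code_dist_attained:
  assumes "finite I" "D \<noteq> {}"
  obtains g where "g \<in> D" "code_dist I f D = hamming_dist I f g"
proof -
  have "hamming_dist I f ` D \<subseteq> (\<lambda>k. real k / real (card I)) ` {..card I}"
    using assms(1) by (auto simp: hamming_dist_def intro!: imageI card_mono)
  then have fin: "finite (hamming_dist I f ` D)"
    by (rule finite_subset) simp
  have "code_dist I f D = Min (hamming_dist I f ` D)"
    unfolding code_dist_def using fin assms(2) by (intro cInf_eq_Min) auto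
  also have "\<dots> \<in> hamming_dist I f ` D"
    using fin assms(2) by (intro Min_in) auto
  finally show ?thesis
    using that by auto
qed

section \<open>Rejection probabilities and incidence counts\<close>

lemma pmf_map_pmf_of_set_False:
  assumes "finite A" "A \<noteq> {}"
  shows "pmf (map_pmf P (pmf_of_set A)) False = real (card {x \<in> A. \<not> P x}) / real (card A)"
proof -
  have "A \<inter> P -` {False} = {x \<in> A. \<not> P x}"
    by auto
  then show ?thesis
    using assms by (simp add: pmf_map measure_pmf_of_set)
qed

lemma sum_card_incidence:
  assumes "finite A" "finite B"
  shows "(\<Sum>i\<in>A. card {s \<in> B. R i s}) = (\<Sum>s\<in>B. card {i \<in> A. R i s})"
  using assms by (rule sum_multicount_gen) simp

text \<open>Two incidence counts are multiplied. Pairs \<open>i \<in> s\<close> with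
  \<open>g i \<noteq> g' i\<close> number at least \<open>D_min n S\<close> per differing coordinate
  and at most \<open>k_max S\<close> per differing local view. All pairs \<open>i \<in> s\<close>
  together give \<open>card S * k_min S \<le> n * D_max n S\<close>, which trades the normalization
  by \<open>n\<close> for that by \<open>card S\<close>.\<close>

lemma hamming_dist_local_views:
  fixes S :: "nat set set"
  assumes S: "\<Union>S = {1..n}" "S \<noteq> {}" "\<And>s. s \<in> S \<Longrightarrow> s \<noteq> {}"
  shows "real (k_min S * D_min n S) / real (k_max S * D_max n S) * hamming_dist {1..n} g g'
    \<le> hamming_dist S (restrict g) (restrict g')"
proof -
  have fin: "finite S"
    using S(1) by (metis finite_UnionD finite_atLeastAtMost)
  have sub: "s \<subseteq> {1..n}" if "s \<in> S" for s
    using S(1) that by auto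
  have fin_s: "finite s" if "s \<in> S" for s
    using sub[OF that] by (rule finite_subset) simp
  have n: "n \<ge> 1"
    using S(2,3) sub by fastforce
  define A where "A = {i \<in> {1..n}. g i \<noteq> g' i}"
  define Y where "Y = {s \<in> S. restrict g s \<noteq> restrict g' s}"
  have k: "k_min S \<le> card s" "card s \<le> k_max S" if "s \<in> S" for s
    using that fin by (auto simp: k_min_def k_max_def)
  have D: "D_min n S \<le> card {s \<in> S. i \<in> s}" "card {s \<in> S. i \<in> s} \<le> D_max n S"
    if "i \<in> {1..n}" for i
    using that by (auto simp: D_min_def D_max_def)
  \<comment> \<open>Positivity of both factors of the denominator allows the fractions to be cleared
    at the end.\<close>
  have k_max: "k_max S > 0"
    using S(2,3) k(2) fin_s by (metis all_not_in_conv card_gt_0_iff order_less_le_trans)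
  have D_max: "D_max n S > 0"
  proof -
    have "1 \<in> \<Union>S"
      using n S(1) by simp
    then have "card {s \<in> S. 1 \<in> s} > 0"
      using fin by (auto simp: card_gt_0_iff)
    then show ?thesis
      using D(2)[of 1] n by simp
  qed
  have "card A * D_min n S \<le> (\<Sum>i\<in>A. card {s \<in> S. i \<in> s})"
    using sum_bounded_below[of A "D_min n S" "\<lambda>i. card {s \<in> S. i \<in> s}"] D(1)
    by (simp add: A_def)
  also have "\<dots> = (\<Sum>s\<in>S. card {i \<in> A. i \<in> s})"
    using fin by (intro sum_card_incidence) (auto simp: A_def)
  \<comment> \<open>Where the two local views agree, \<open>s\<close> contains no coordinate of
    \<open>A\<close>, so only \<open>Y\<close> contributes.\<close>
  also have "\<dots> = (\<Sum>s\<in>Y. card {i \<in> A. i \<in> s})"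
  proof (rule sum.mono_neutral_right[OF fin])
    show "\<forall>s\<in>S - Y. card {i \<in> A. i \<in> s} = 0"
    proof
      fix s assume "s \<in> S - Y"
      then have "restrict g s = restrict g' s"
        by (auto simp: Y_def)
      then have "{i \<in> A. i \<in> s} = {}"
        unfolding A_def by (auto; metis restrict_apply')
      then show "card {i \<in> A. i \<in> s} = 0"
        by (simp only: card.empty)
    qed
  qed (auto simp: Y_def)
  also have "\<dots> \<le> (\<Sum>s\<in>Y. k_max S)"
  proof (rule sum_mono)
    fix s assume "s \<in> Y"
    then have "s \<in> S"
      by (simp add: Y_def)
    then have "card {i \<in> A. i \<in> s} \<le> card s"
      using fin_s by (intro card_mono) auto
    then show "card {i \<in> A. i \<in> s} \<le> k_max S"
      using k(2)[OF \<open>s \<in> S\<close>] by linarith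
  qed
  finally have 1: "card A * D_min n S \<le> card Y * k_max S"
    by simp
  have "card S * k_min S \<le> (\<Sum>s\<in>S. card s)"
    using sum_bounded_below[of S "k_min S" card] k(1) by simp
  also have "\<dots> = (\<Sum>s\<in>S. card {i \<in> {1..n}. i \<in> s})"
    using sub by (intro sum.cong refl arg_cong[of _ _ card]) blast
  also have "\<dots> = (\<Sum>i\<in>{1..n}. card {s \<in> S. i \<in> s})"
    using fin by (intro sum_card_incidence[symmetric]) auto
  also have "\<dots> \<le> n * D_max n S"
    using sum_bounded_above[of "{1..n}" "\<lambda>i. card {s \<in> S. i \<in> s}" "D_max n S"] D(2) by simp
  finally have 2: "card S * k_min S \<le> n * D_max n S" .
  have "(card A * D_min n S) * (card S * k_min S) \<le> (card Y * k_max S) * (n * D_max n S)"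
    using 1 2 by (rule mult_le_mono)
  then have "real ((card A * D_min n S) * (card S * k_min S))
      \<le> real ((card Y * k_max S) * (n * D_max n S))"
    by (simp only: of_nat_le_iff)
  moreover have "card S > 0"
    using fin S(2) by (simp add: card_gt_0_iff)
  ultimately show ?thesis
    using k_max D_max n
    unfolding hamming_dist_def A_def[symmetric] Y_def[symmetric]
    by (simp add: field_simps)
qed

section \<open>Passing between the lifted code and the line code\<close>

lemma restrict_lifted_code_in_line_code:
  assumes "g \<in> lifted_code n \<Sigma> S C"
  shows "restrict (restrict g) S \<in> line_code S C"
proof -
  have "restrict (restrict g s) (s \<inter> s') = restrict (restrict g s') (s \<inter> s')" for s s'
    by (rule restrict_ext) simp
  moreover have "restrict (restrict g) S \<in> Pi\<^sub>E S C"
    using assms by (simp add: lifted_code_def)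
  ultimately show ?thesis
    unfolding line_code_def by simp
qed

text \<open>The members of \<open>h\<close> agree on overlaps, so the value at \<open>i\<close> may
  be read off from any \<open>s\<close> containing \<open>i\<close>; since the sets cover
  \<open>{1..n}\<close>, this determines a whole word.\<close>

lemma line_code_glue:
  assumes S: "\<Union>S = {1..n}"
    and C: "\<And>s. s \<in> S \<Longrightarrow> C s \<subseteq> s \<rightarrow>\<^sub>E \<Sigma>"
    and h: "h \<in> line_code S C"
  obtains g where "g \<in> lifted_code n \<Sigma> S C" "\<And>s. s \<in> S \<Longrightarrow> restrict g s = h s"
proof -
  have "\<exists>s. s \<in> S \<and> i \<in> s" if "i \<in> {1..n}" for i
    using S that by auto
  then obtain t where t: "\<And>i. i \<in> {1..n} \<Longrightarrow> t i \<in> S \<and> i \<in> t i"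
    by metis
  define g where "g = (\<lambda>i\<in>{1..n}. h (t i) i)"
  have hC: "h s \<in> C s" if "s \<in> S" for s
    using h that by (auto simp: line_code_def)
  have agree: "h s i = h s' i" if "s \<in> S" "s' \<in> S" "i \<in> s" "i \<in> s'" for s s' i
  proof -
    have "restrict (h s) (s \<inter> s') = restrict (h s') (s \<inter> s')"
      using h that by (auto simp: line_code_def)
    then show ?thesis
      using that by (metis IntI restrict_apply')
  qed
  have g: "restrict g s = h s" if "s \<in> S" for s
  proof
    fix i
    show "restrict g s i = h s i"
    proof (cases "i \<in> s")
      case True
      then have "i \<in> {1..n}"
        using S that by auto
      then show ?thesis
        using True t[of i] agree[of "t i" s i] that by (simp add: g_def)
    next
      case False
      \<comment> \<open>Outside \<open>s\<close> equality rests on extensionality: both sides are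
        \<open>undefined\<close>.\<close>
      have "h s \<in> s \<rightarrow>\<^sub>E \<Sigma>"
        using hC[OF that] C[OF that] by blast
      then have "h s i = undefined"
        using False by (rule PiE_arb)
      then show ?thesis
        using False by simp
    qed
  qed
  have "g \<in> {1..n} \<rightarrow>\<^sub>E \<Sigma>"
  proof (unfold g_def, rule restrict_PiE_iff[THEN iffD2], rule ballI)
    fix i assume "i \<in> {1..n}"
    then show "h (t i) i \<in> \<Sigma>"
      using t[of i] hC[of "t i"] C[of "t i"] by (auto dest: PiE_mem)
  qed
  then have "g \<in> lifted_code n \<Sigma> S C"
    using g hC by (simp add: lifted_code_def)
  then show ?thesis
    using g that by blast
qed

section \<open>Edge counting and the edge tester\<close>

lemma (in multigraph) handshake:
  "(\<Sum>v\<in>V. vertex_degree E ends v) = 2 * card E"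
proof -
  have "(\<Sum>v\<in>V. vertex_degree E ends v) = (\<Sum>e\<in>E. card {v \<in> V. v \<in> ends e})"
    unfolding vertex_degree_def using finite_V finite_E by (rule sum_card_incidence)
  also have "\<dots> = (\<Sum>e\<in>E. 2)"
  proof (rule sum.cong[OF refl])
    fix e assume "e \<in> E"
    then have "{v \<in> V. v \<in> ends e} = ends e"
      using ends_subset by auto
    then show "card {v \<in> V. v \<in> ends e} = 2"
      using card_ends[OF \<open>e \<in> E\<close>] by simp
  qed
  finally show ?thesis
    by simp
qed

text \<open>A union bound over \<open>W\<close>; edges with both endpoints in \<open>W\<close> are
  counted twice, which only weakens the estimate.\<close>

lemma (in multigraph) card_edges_meeting_le:
  assumes "W \<subseteq> V" "\<And>v. v \<in> V \<Longrightarrow> vertex_degree E ends v \<le> d"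
  shows "card {e \<in> E. ends e \<inter> W \<noteq> {}} \<le> d * card W"
proof -
  have "finite W"
    using assms(1) finite_V by (rule finite_subset)
  have "{e \<in> E. ends e \<inter> W \<noteq> {}} = (\<Union>v\<in>W. {e \<in> E. v \<in> ends e})"
    by auto
  then have "card {e \<in> E. ends e \<inter> W \<noteq> {}} \<le> (\<Sum>v\<in>W. vertex_degree E ends v)"
    using card_UN_le[OF \<open>finite W\<close>, of "\<lambda>v. {e \<in> E. v \<in> ends e}"]
    by (simp add: vertex_degree_def)
  also have "\<dots> \<le> (\<Sum>v\<in>W. d)"
    using assms by (intro sum_mono) auto
  finally show ?thesis
    by (simp add: mult.commute)
qed

text \<open>An edge whose endpoints both carry local views of \<open>g\<close> is accepted, so a
  rejected edge meets a vertex where \<open>f\<close> deviates from \<open>g\<close>. At most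
  \<open>d_max\<close> edges meet each such vertex, while the handshake identity gives
  \<open>card E\<close> at least \<open>card V * d_min / 2\<close>; this is where the factor 2
  arises.\<close>

lemma (in multigraph) edge_tester_reject_le:
  assumes V: "bij_betw lV V S" "V \<noteq> {}"
    and lE: "\<And>e v. e \<in> E \<Longrightarrow> v \<in> ends e \<Longrightarrow> lE e \<subseteq> lV v"
    and d: "d_min \<ge> 1"
      "\<And>v. v \<in> V \<Longrightarrow> d_min \<le> vertex_degree E ends v \<and> vertex_degree E ends v \<le> d_max"
  shows "pmf (edge_tester E ends lV lE f) False
    \<le> 2 * real d_max / real d_min * hamming_dist S (restrict g) f"
proof -
  define W where "W = {v \<in> V. restrict g (lV v) \<noteq> f (lV v)}"
  define R where "R = {e \<in> E. \<not> (\<forall>u\<in>ends e. \<forall>v\<in>ends e.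
    restrict (f (lV u)) (lE e) = restrict (f (lV v)) (lE e))}"
  have "card V * d_min \<le> (\<Sum>v\<in>V. vertex_degree E ends v)"
    using sum_bounded_below[of V d_min "vertex_degree E ends"] d(2) by simp
  then have edges: "card V * d_min \<le> 2 * card E"
    by (simp add: handshake)
  have V0: "card V > 0"
    using V(2) finite_V by (simp add: card_gt_0_iff)
  \<comment> \<open>There is a vertex, and it has an edge, so \<open>pmf_of_set E\<close> really is
    the uniform distribution.\<close>
  have E0: "card E > 0"
    using edges V0 d(1) by (cases "card E") auto
  have "R \<subseteq> {e \<in> E. ends e \<inter> W \<noteq> {}}"
  proof
    fix e assume e: "e \<in> R"
    have "False" if "ends e \<inter> W = {}"
    proof -
      \<comment> \<open>As \<open>lE e\<close> lies inside the label of \<open>v\<close>, the view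
        at \<open>v\<close> shows \<open>g\<close> itself on \<open>lE e\<close>, whichever endpoint
        \<open>v\<close> is.\<close>
      have "restrict (f (lV v)) (lE e) = restrict g (lE e)" if "v \<in> ends e" for v
      proof -
        have "f (lV v) = restrict g (lV v)"
          using that \<open>ends e \<inter> W = {}\<close> e ends_subset[of e] by (auto simp: W_def R_def)
        moreover have "lE e \<subseteq> lV v"
          using lE that e by (auto simp: R_def)
        ultimately show ?thesis
          by (simp add: Int_absorb1)
      qed
      then show False
        using e by (auto simp: R_def)
    qed
    then show "e \<in> {e \<in> E. ends e \<inter> W \<noteq> {}}"
      using e by (auto simp: R_def)
  qed
  then have "card R \<le> card {e \<in> E. ends e \<inter> W \<noteq> {}}"
    using finite_E by (intro card_mono) auto
  also have "\<dots> \<le> d_max * card W"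
    using d(2) by (intro card_edges_meeting_le) (auto simp: W_def)
  finally have "card R \<le> d_max * card W" .
  then have "card R * (card V * d_min) \<le> d_max * card W * (2 * card E)"
    using edges by (rule mult_le_mono)
  then have "real (card R * (card V * d_min)) \<le> real (d_max * card W * (2 * card E))"
    by (simp only: of_nat_le_iff)
  then have "real (card R) / real (card E)
      \<le> 2 * real d_max / real d_min * (real (card W) / real (card V))"
    using V0 E0 d(1) by (simp add: field_simps)
  \<comment> \<open>The bijection \<open>lV\<close> turns fractions of vertices into fractions of
    \<open>S\<close>.\<close>
  moreover have "bij_betw lV W {s \<in> S. restrict g s \<noteq> f s}"
    using V(1) by (auto simp: W_def bij_betw_def inj_on_def)
  then have "card W = card {s \<in> S. restrict g s \<noteq> f s}"
    by (rule bij_betw_same_card)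
  moreover have "card V = card S"
    using V(1) by (rule bij_betw_same_card)
  moreover have "pmf (edge_tester E ends lV lE f) False = real (card R) / real (card E)"
    unfolding edge_tester_def R_def
    using E0 by (intro pmf_map_pmf_of_set_False) (auto simp: card_gt_0_iff)
  ultimately show ?thesis
    by (simp add: hamming_dist_def)
qed

section \<open>Soundness of the natural tester\<close>

theorem theorem3p10:
  fixes n :: nat and \<Sigma> :: "'a set" and S :: "nat set set"
    and C :: "nat set \<Rightarrow> (nat \<Rightarrow> 'a) set"
    and V :: "'v set" and E :: "'e set" and ends :: "'e \<Rightarrow> 'v set"
    and lV :: "'v \<Rightarrow> nat set" and lE :: "'e \<Rightarrow> nat set"
    and d_min d_max :: nat and \<mu> :: real
  assumes "finite \<Sigma>"
    and "\<And>s. s \<in> S \<Longrightarrow> s \<noteq> {}"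
    and "\<Union>S = {1..n}"
    and "\<And>s. s \<in> S \<Longrightarrow> C s \<subseteq> s \<rightarrow>\<^sub>E \<Sigma>"
    and "\<And>s. s \<in> S \<Longrightarrow> C s \<noteq> {}"
    and "lifted_code n \<Sigma> S C \<noteq> {}"
    and "\<And>s s'. s \<in> S \<Longrightarrow> s' \<in> S \<Longrightarrow> card (C s) = card (C s')"
    and "multigraph V E ends"
    and "bij_betw lV V S"
    and "\<And>e. e \<in> E \<Longrightarrow> lE e \<subseteq> {1..n}"
    and "\<And>e v. e \<in> E \<Longrightarrow> v \<in> ends e \<Longrightarrow> lE e \<subseteq> lV v"
    and "d_min \<ge> 1"
    and "\<And>v. v \<in> V \<Longrightarrow> d_min \<le> vertex_degree E ends v \<and> vertex_degree E ends v \<le> d_max"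
    and "\<mu> \<ge> 0"
    and "has_soundness S (Pi\<^sub>E S C) (line_code S C) (edge_tester E ends lV lE) \<mu>"
  shows "has_soundness {1..n} ({1..n} \<rightarrow>\<^sub>E \<Sigma>) (lifted_code n \<Sigma> S C) (natural_tester S C)
    (real (k_min S * D_min n S) / real (k_max S * D_max n S)
       * (\<mu> / (\<mu> + 2 * real d_max / real d_min)))"
proof -
  interpret multigraph V E ends
    by fact
  define r where "r = 2 * real d_max / real d_min"
  define c where "c = real (k_min S * D_min n S) / real (k_max S * D_max n S)"
  have r: "r \<ge> 0" and c: "c \<ge> 0"
    by (simp_all add: r_def c_def)
  have fin: "finite S"
    using assms(3) by (metis finite_UnionD finite_atLeastAtMost)
  have "c * (\<mu> / (\<mu> + r)) * code_dist {1..n} g (lifted_code n \<Sigma> S C)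
      \<le> pmf (natural_tester S C g) False" for g
  proof (cases "\<mu> = 0 \<or> S = {}")
    \<comment> \<open>In the degenerate cases the left side is 0 and a probability is nonnegative.
      For \<open>S = {}\<close> the word length is 0, and the distance is 0 because division by zero
      yields 0.\<close>
    case True
    have "code_dist {1..n} g (lifted_code n \<Sigma> S C) = 0" if "S = {}"
    proof -
      have "{1..n} = {}"
        using that assms(3) by simp
      moreover obtain g' where
        "code_dist {1..n} g (lifted_code n \<Sigma> S C) = hamming_dist {1..n} g g'"
        using code_dist_attained[OF finite_atLeastAtMost assms(6)] by metis
      ultimately show ?thesis
        by (simp add: hamming_dist_def)
    qed
    then show ?thesis
      using True by auto
  next
    case False
    then have mu: "\<mu> > 0" and S: "S \<noteq> {}"
      using assms(14) by auto
    have V: "V \<noteq> {}"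
      using S assms(9) by (auto simp: bij_betw_def)
    define f where
      "f = (\<lambda>s\<in>S. if restrict g s \<in> C s then restrict g s else SOME w. w \<in> C s)"
    have f: "f \<in> Pi\<^sub>E S C"
      using assms(5) by (auto simp: f_def some_in_eq)
    \<comment> \<open>A nearest codeword \<open>h\<close> exists only in a nonempty line code; the
      local views of any word of the lifted code supply a member.\<close>
    have L: "line_code S C \<noteq> {}"
      using assms(6) restrict_lifted_code_in_line_code by blast
    obtain h where h: "h \<in> line_code S C"
      and dist_h: "code_dist S f (line_code S C) = hamming_dist S f h"
      using code_dist_attained[OF fin L] by metis
    obtain g' where g': "g' \<in> lifted_code n \<Sigma> S C" "\<And>s. s \<in> S \<Longrightarrow> restrict g' s = h s"
      using line_code_glue[OF assms(3,4) h] by blast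
    define p where "p = hamming_dist S (restrict g) f"
    have p: "pmf (natural_tester S C g) False = p"
    proof -
      \<comment> \<open>A replacement lies in \<open>C s\<close> and a violated view does not, so
        \<open>f\<close> differs from the local views exactly at the violated sets. Hence
        \<open>p\<close> equals the rejection probability, not merely a bound for it.\<close>
      have "f s = restrict g s \<longleftrightarrow> restrict g s \<in> C s" if "s \<in> S" for s
      proof (cases "restrict g s \<in> C s")
        case True
        then show ?thesis
          using that by (simp add: f_def)
      next
        case False
        then have "f s \<in> C s"
          using f that by blast
        then show ?thesis
          using False by metis
      qed
      then have "{s \<in> S. restrict g s \<notin> C s} = {s \<in> S. restrict g s \<noteq> f s}"
        by (intro Collect_cong) metis
      then show ?thesis
        using pmf_map_pmf_of_set_False[OF fin S, of "\<lambda>s. restrict g s \<in> C s"]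
        by (simp add: natural_tester_def p_def hamming_dist_def)
    qed
    have "\<mu> * hamming_dist S f h \<le> pmf (edge_tester E ends lV lE f) False"
      using assms(15) f dist_h by (auto simp: has_soundness_def)
    also have "\<dots> \<le> r * p"
      unfolding r_def p_def
      using edge_tester_reject_le[OF assms(9) V assms(11,12,13)] .
    finally have fh: "\<mu> * hamming_dist S f h \<le> r * p" .
    define y where "y = hamming_dist S (restrict g) (restrict g')"
    have "hamming_dist S (restrict g) h = y"
      using g'(2) by (simp add: y_def hamming_dist_def cong: conj_cong)
    then have "y \<le> p + hamming_dist S f h"
      using hamming_dist_triangle[OF fin, of "restrict g" h f] by (simp add: p_def)
    \<comment> \<open>Weighting the triangle inequality by \<open>\<mu>\<close> makes
      \<open>fh\<close> applicable; the resulting \<open>\<mu> * y \<le> (\<mu> + r) * p\<close> is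
      the origin of the factor \<open>\<mu> / (\<mu> + r)\<close>.\<close>
    then have "\<mu> * y \<le> \<mu> * p + \<mu> * hamming_dist S f h"
      using mu by (metis distrib_left mult_left_mono less_imp_le)
    then have "\<mu> * y \<le> (\<mu> + r) * p"
      using fh by (simp add: distrib_right)
    then have y: "\<mu> / (\<mu> + r) * y \<le> p"
      using mu r by (simp add: field_simps)
    \<comment> \<open>The glued word \<open>g'\<close> need not be nearest to \<open>g\<close>; as a
      codeword it still bounds the distance to the code from above.\<close>
    have "c * code_dist {1..n} g (lifted_code n \<Sigma> S C) \<le> c * hamming_dist {1..n} g g'"
      using code_dist_le[OF g'(1)] c by (intro mult_left_mono)
    also have "\<dots> \<le> y"
      unfolding c_def y_def using assms(3) S assms(2) by (rule hamming_dist_local_views)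
    finally have "\<mu> / (\<mu> + r) * (c * code_dist {1..n} g (lifted_code n \<Sigma> S C))
        \<le> \<mu> / (\<mu> + r) * y"
      using mu r by (intro mult_left_mono) auto
    then show ?thesis
      using y p by (simp add: ac_simps)
  qed
  then show ?thesis
    unfolding has_soundness_def c_def r_def by blast
qed

end
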